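(* Let $(X,\|\cdot\|_n)$ and $(Y,|\cdot|_n)$ be Fréchet spaces and let $F:X\rightrightarrows Y$ be a multi-valued map with closed graph. Let $U\subset X$ and $V\subset Y$ be open and such that $\mathrm{Gr}\,F\cap(U\times V)\ne\emptyset$. Assume that for some $\mathbf{s}\in\mathbb{R}_+^\infty$ and some non-empty set $C\subset Y$ it holds that $$D'F(x,y)(\Pi_{\mathbf{s}}(X))\supset C,\quad\forall (x,y)\in(U\times V)\cap\mathrm{Gr}\,F,$$ and let, moreover, $\Pi_{\mathbf{s}}(X)$ be compact. Then $$F(x+\Pi_{\mathbf{s}}(X))\supset y+C$$ for all $(x,y)\in\mathrm{Gr}\,F$ such that $x+\Pi_{\mathbf{s}}(X)\subset U$ and $[y,y+C]\subset V$.
   Context: A Fréchet space $(X,\|\cdot\|_n)$ is a linear space $X$ with a fixed collection of seminorms $\|\cdot\|_n$, $n=0,1,2,\ldots$, which is separating ($\|x\|_n=0$ for all $n$ iff $x=0$) and such that $X$ is complete in the metric $$\rho_X(x,y):=\max_{n\ge 0}\frac{2^{-n}\|x-y\|_n}{1+\|x-y\|_n}.$$ Topological notions in $X$ refer to $\rho_X$; similarly for $Y$ with $\rho_Y$ built from $|\cdot|_n$. $\mathbb{R}_+^\infty:=\{(s_i)_{i=0}^\infty:\ s_i\ge 0\}$. For $\mathbf{s}=(s_i)_{i=0}^\infty\in\mathbb{R}_+^\infty$, $\Pi_{\mathbf{s}}(X):=\{x\in X:\ \|x\|_n\le s_n,\ \forall n\ge 0\}$. For a multi-valued map $F$ (values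 are subsets of $Y$, possibly empty), $\mathrm{Gr}\,F:=\{(x,y):\ y\in F(x)\}$ and $F(A):=\bigcup_{a\in A}F(a)$. For $(x,y)\in\mathrm{Gr}\,F$ and a non-empty set $A\subset X$, the set $D'F(x,y)(A)\subset Y$ is defined by $$v\in D'F(x,y)(A)\iff \exists\, t_n\downarrow 0:\ \lim_{n\to\infty}\frac{\inf\rho_Y(F(x+t_nA),\,y+t_nv)}{t_n}=0,$$ where $\inf\rho_Y(B,z):=\inf_{b\in B}\rho_Y(b,z)$ (with $\inf\emptyset=+\infty$). For $y\in Y$ and non-empty $C\subset Y$, $[y,y+C]:=\{y+tc:\ c\in C,\ t\in[0,1]\}$. *)

theory Defs
  imports "HOL-Analysis.Analysis"
begin

definition seminorm :: "('a::real_vector \<Rightarrow> real) \<Rightarrow> bool" where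
  "seminorm p \<longleftrightarrow>
     (\<forall>x. 0 \<le> p x) \<and>
     (\<forall>x y. p (x + y) \<le> p x + p y) \<and>
     (\<forall>c x. p (c *\<^sub>R x) = \<bar>c\<bar> * p x)"

(* The supremum is attained (see frechet_dist_attained), i.e. it is the maximum over n. *)
definition frechet_dist :: "(nat \<Rightarrow> 'a::real_vector \<Rightarrow> real) \<Rightarrow> 'a \<Rightarrow> 'a \<Rightarrow> real" where
  "frechet_dist p x y = (SUP n. (1/2) ^ n * p n (x - y) / (1 + p n (x - y)))"

abbreviation frechet_topology :: "(nat \<Rightarrow> 'a::real_vector \<Rightarrow> real) \<Rightarrow> 'a topology" where
  "frechet_topology p \<equiv> Metric_space.mtopology UNIV (frechet_dist p)"

locale frechet_space =
  fixes p :: "nat \<Rightarrow> 'a::real_vector \<Rightarrow> real"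
  assumes seminorms: "seminorm (p n)"
    and separating: "(\<forall>n. p n x = 0) \<longleftrightarrow> x = 0"
    and complete: "Metric_space.mcomplete UNIV (frechet_dist p)"

definition seminorm_box :: "(nat \<Rightarrow> 'a::real_vector \<Rightarrow> real) \<Rightarrow> (nat \<Rightarrow> real) \<Rightarrow> 'a set" where
  "seminorm_box p s = {x. \<forall>n. p n x \<le> s n}"

definition Gr :: "('a \<Rightarrow> 'b set) \<Rightarrow> ('a \<times> 'b) set" where
  "Gr F = {(x, y). y \<in> F x}"

definition mv_image :: "('a \<Rightarrow> 'b set) \<Rightarrow> 'a set \<Rightarrow> 'b set" where
  "mv_image F A = (\<Union>a\<in>A. F a)"

(* The infimum is taken in the extended reals, where the empty set has infimum \<infinity>. *)
definition inf_dist :: "('b \<Rightarrow> 'b \<Rightarrow> real) \<Rightarrow> 'b set \<Rightarrow> 'b \<Rightarrow> ereal" where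
  "inf_dist d B z = (INF b\<in>B. ereal (d b z))"

definition D' :: "(nat \<Rightarrow> 'b::real_vector \<Rightarrow> real) \<Rightarrow> ('a::real_vector \<Rightarrow> 'b set) \<Rightarrow> 'a \<Rightarrow> 'b
    \<Rightarrow> 'a set \<Rightarrow> 'b set" where
  "D' q F x y A = {v. \<exists>t :: nat \<Rightarrow> real. (\<forall>n. 0 < t n) \<and> decseq t \<and> t \<longlonglongrightarrow> 0 \<and>
     (\<lambda>n. inf_dist (frechet_dist q) (mv_image F ((\<lambda>a. x + t n *\<^sub>R a) ` A)) (y + t n *\<^sub>R v)
            / ereal (t n)) \<longlonglongrightarrow> 0}"

definition segments :: "'b::real_vector \<Rightarrow> 'b set \<Rightarrow> 'b set" where
  "segments y C = {y + t *\<^sub>R c | t c. c \<in> C \<and> 0 \<le> t \<and> t \<le> 1}"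

context frechet_space
begin

lemma seminorm_nonneg: "0 \<le> p n x"
  using seminorms[of n] by (simp add: seminorm_def)

lemma seminorm_triangle: "p n (x + y) \<le> p n x + p n y"
  using seminorms[of n] by (simp add: seminorm_def)

lemma seminorm_minus_commute: "p n (x - y) = p n (y - x)"
proof -
  have "p n ((-1) *\<^sub>R (y - x)) = \<bar>-1\<bar> * p n (y - x)"
    using seminorms[of n] unfolding seminorm_def by blast
  then show ?thesis by simp
qed

definition dist_term :: "'a \<Rightarrow> 'a \<Rightarrow> nat \<Rightarrow> real" where
  "dist_term x y n = (1/2) ^ n * p n (x - y) / (1 + p n (x - y))"

lemma frechet_dist_eq: "frechet_dist p x y = (SUP n. dist_term x y n)"
  by (simp add: frechet_dist_def dist_term_def)

lemma dist_term_nonneg: "0 \<le> dist_term x y n"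
  using seminorm_nonneg[of n "x - y"] by (simp add: dist_term_def)

lemma dist_term_le: "dist_term x y n \<le> (1/2) ^ n"
proof -
  have "p n (x - y) / (1 + p n (x - y)) \<le> 1"
    using seminorm_nonneg[of n "x - y"] by simp
  from mult_left_mono[OF this, of "(1/2) ^ n"] show ?thesis
    by (simp add: dist_term_def)
qed

lemma bdd_above_dist_term: "bdd_above (range (dist_term x y))"
proof (rule bdd_aboveI2)
  fix n
  show "dist_term x y n \<le> 1"
    using dist_term_le[of x y n] power_le_one[of "1/2::real" n] by simp
qed

lemma dist_term_le_dist: "dist_term x y n \<le> frechet_dist p x y"
  unfolding frechet_dist_eq by (rule cSUP_upper[OF UNIV_I bdd_above_dist_term])

lemma dist_term_triangle: "dist_term x z n \<le> dist_term x y n + dist_term y z n"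
proof -
  let ?a = "p n (x - y)" and ?b = "p n (y - z)" and ?c = "p n (x - z)"
  have ab: "0 \<le> ?a" "0 \<le> ?b" "0 \<le> ?c" by (auto intro: seminorm_nonneg)
  have c: "?c \<le> ?a + ?b" using seminorm_triangle[of n "x - y" "y - z"] by simp
  have "?c / (1 + ?c) \<le> (?a + ?b) / (1 + (?a + ?b))"
    using ab c by (simp add: divide_simps algebra_simps)
  also have "\<dots> = ?a / (1 + (?a + ?b)) + ?b / (1 + (?a + ?b))"
    by (simp add: add_divide_distrib)
  also have "\<dots> \<le> ?a / (1 + ?a) + ?b / (1 + ?b)"
    using ab by (intro add_mono divide_left_mono) auto
  finally have "(1/2) ^ n * (?c / (1 + ?c)) \<le> (1/2) ^ n * (?a / (1 + ?a) + ?b / (1 + ?b))"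
    by (intro mult_left_mono) auto
  then show ?thesis by (simp add: dist_term_def distrib_left)
qed

lemma frechet_dist_attained: "\<exists>n. frechet_dist p x y = dist_term x y n"
proof (cases "\<forall>n. dist_term x y n = 0")
  case True
  then show ?thesis by (simp add: frechet_dist_eq)
next
  case False
  then obtain m where "dist_term x y m \<noteq> 0" by blast
  then have m: "0 < dist_term x y m" using dist_term_nonneg[of x y m] by simp
  obtain N where N: "(1/2::real) ^ N < dist_term x y m"
    using real_arch_pow_inv[OF m, of "1/2"] by auto
  let ?M = "Max (dist_term x y ` {..max m N})"
  have "?M \<in> dist_term x y ` {..max m N}" by (rule Max_in) auto
  then obtain k where k: "?M = dist_term x y k" by blast
  have "dist_term x y n \<le> dist_term x y k" for n
  proof (cases "n \<le> max m N")
    case True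
    then show ?thesis unfolding k[symmetric] by (intro Max_ge) auto
  next
    case False
    have "dist_term x y n \<le> (1/2) ^ N"
      by (rule order_trans[OF dist_term_le power_decreasing]) (use False in auto)
    also have "\<dots> \<le> dist_term x y m" using N by simp
    also have "\<dots> \<le> dist_term x y k" unfolding k[symmetric] by (intro Max_ge) auto
    finally show ?thesis .
  qed
  then have "frechet_dist p x y = dist_term x y k"
    unfolding frechet_dist_eq
    by (intro antisym cSUP_least cSUP_upper bdd_above_dist_term) auto
  then show ?thesis ..
qed

lemma Metric_space_frechet_dist: "Metric_space UNIV (frechet_dist p)"
proof
  fix x y z :: 'a
  show "0 \<le> frechet_dist p x y"
    using dist_term_nonneg dist_term_le_dist by (rule order_trans)
  show "frechet_dist p x y = frechet_dist p y x"
    by (simp add: frechet_dist_def seminorm_minus_commute[of _ x y])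
  show "frechet_dist p x y = 0 \<longleftrightarrow> x = y"
  proof
    assume "frechet_dist p x y = 0"
    then have "dist_term x y n = 0" for n
      using dist_term_le_dist[of x y n] dist_term_nonneg[of x y n] by simp
    then have zero: "dist_term x y n = 0" for n .
    have "p n (x - y) = 0" for n
    proof -
      have "p n (x - y) = 0 \<or> 1 + p n (x - y) = 0"
        using zero[of n] by (simp add: dist_term_def)
      then show ?thesis using seminorm_nonneg[of n "x - y"] by linarith
    qed
    then show "x = y" using separating[of "x - y"] by simp
  next
    assume "x = y"
    moreover have "\<forall>n. p n 0 = 0" using separating[of 0] by simp
    ultimately show "frechet_dist p x y = 0"
      by (simp add: frechet_dist_def)
  qed
  obtain n where "frechet_dist p x z = dist_term x z n"
    using frechet_dist_attained by blast
  then show "frechet_dist p x z \<le> frechet_dist p x y + frechet_dist p y z"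
    using dist_term_triangle[of x z n y] dist_term_le_dist[of x y n] dist_term_le_dist[of y z n]
    by linarith
qed

end

end

theory Submission
  imports Defs
begin

text \<open>Fix \<open>\<epsilon> > 0\<close> and follow the target \<open>y + t c\<close> for \<open>t\<close> from 0 to 1, keeping a point
  \<open>(x\<^sub>t, y\<^sub>t)\<close> of the graph with \<open>x\<^sub>t \<in> x + t K\<close>, where \<open>K\<close> is the seminorm box, and \<open>y\<^sub>t\<close> within
  \<open>\<epsilon> t\<close> of the target. The derivative condition extends any such path a little beyond
  \<open>t < 1\<close>, and limits exist because \<open>K\<close> is compact and \<open>Y\<close> is complete, so the ordering principle of
  Brezis and Browder yields a path up to \<open>t = 1\<close>. Finally \<open>\<epsilon>\<close> tends to 0, using once more that
  \<open>K\<close> is compact and the graph closed.\<close>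

section \<open>The ordering principle of Brezis and Browder\<close>

text \<open>A greedy sequence chooses \<open>f (Suc k)\<close> so that no successor of
  \<open>f k\<close> exceeds it in \<open>\<tau>\<close> by more than 1/(k+1). If an upper bound
  \<open>z\<close> of the sequence had \<open>\<tau> z < b\<close>, a strictly larger successor of
  \<open>z\<close> would by transitivity succeed every \<open>f k\<close>, so its gain over
  \<open>z\<close> would be at most 1/(k+1) for all k.\<close>

lemma brezis_browder:
  fixes \<tau> :: "'z \<Rightarrow> real"
  assumes refl: "\<And>z. z \<in> S \<Longrightarrow> R z z"
    and trans: "\<And>u v w. R u v \<Longrightarrow> R v w \<Longrightarrow> R u w"
    and mono: "\<And>u v. R u v \<Longrightarrow> \<tau> u \<le> \<tau> v"
    and bound: "\<And>z. z \<in> S \<Longrightarrow> \<tau> z \<le> b"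
    and chain: "\<And>f. (\<And>k. f k \<in> S) \<Longrightarrow> (\<And>k. R (f k) (f (Suc k))) \<Longrightarrow> \<exists>z\<in>S. \<forall>k. R (f k) z"
    and step: "\<And>z. z \<in> S \<Longrightarrow> \<tau> z < b \<Longrightarrow> \<exists>z'\<in>S. R z z' \<and> \<tau> z < \<tau> z'"
    and "z0 \<in> S"
  shows "\<exists>z\<in>S. \<tau> z = b"
proof -
  have near_sup: "\<exists>z'\<in>S. R z z' \<and> (\<forall>w\<in>S. R z w \<longrightarrow> \<tau> w \<le> \<tau> z' + e)" if z: "z \<in> S" and "e > 0" for z e
  proof -
    let ?T = "\<tau> ` {w \<in> S. R z w}"
    have ne: "?T \<noteq> {}" using refl z by blast
    have bdd: "bdd_above ?T" using bound by (intro bdd_aboveI[of _ b]) auto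
    have "Sup ?T - e < Sup ?T" using \<open>e > 0\<close> by simp
    then obtain z' where z': "z' \<in> S" "R z z'" "Sup ?T - e < \<tau> z'"
      using less_cSupD[OF ne] by blast
    have "\<tau> w \<le> Sup ?T" if "w \<in> S" "R z w" for w
      using that by (intro cSup_upper bdd) auto
    with z' show ?thesis by fastforce
  qed
  have "\<exists>f. \<forall>k. f k \<in> S \<and> (R (f k) (f (Suc k)) \<and>
          (\<forall>w\<in>S. R (f k) w \<longrightarrow> \<tau> w \<le> \<tau> (f (Suc k)) + inverse (real (Suc k))))"
  proof (rule dependent_nat_choice)
    show "\<exists>z'. z' \<in> S \<and> (R z z' \<and> (\<forall>w\<in>S. R z w \<longrightarrow> \<tau> w \<le> \<tau> z' + inverse (real (Suc k))))"
      if "z \<in> S" for z k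
      using near_sup[OF that, of "inverse (real (Suc k))"] by auto
  qed (use \<open>z0 \<in> S\<close> in blast)
  then obtain f where f: "\<And>k. f k \<in> S" "\<And>k. R (f k) (f (Suc k))"
    and f_sup: "\<And>k w. w \<in> S \<Longrightarrow> R (f k) w \<Longrightarrow> \<tau> w \<le> \<tau> (f (Suc k)) + inverse (real (Suc k))"
    by blast
  obtain z where z: "z \<in> S" "\<And>k. R (f k) z"
    using chain[of f] f by blast
  have "\<not> \<tau> z < b"
  proof
    assume "\<tau> z < b"
    then obtain z' where z': "z' \<in> S" "R z z'" "\<tau> z < \<tau> z'" using step z by blast
    then obtain k where k: "inverse (real (Suc k)) < \<tau> z' - \<tau> z"
      using reals_Archimedean[of "\<tau> z' - \<tau> z"] by auto
    have "\<tau> z' \<le> \<tau> (f (Suc k)) + inverse (real (Suc k))"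
      using f_sup z' z trans by blast
    moreover have "\<tau> (f (Suc k)) \<le> \<tau> z" using mono z by blast
    ultimately show False using k by linarith
  qed
  with bound z show ?thesis by (meson not_le antisym_conv1)
qed

section \<open>Convergence in the metric and in the seminorms\<close>

context frechet_space
begin

sublocale Metric_space UNIV "frechet_dist p"
  by (rule Metric_space_frechet_dist)

lemma frechet_dist_translate: "frechet_dist p (z + x) (z + y) = frechet_dist p x y"
  by (simp add: frechet_dist_def)

lemma seminorm_scale: "p n (a *\<^sub>R x) = \<bar>a\<bar> * p n x"
  using seminorms[of n] by (simp add: seminorm_def)

text \<open>Terms with index at least \<open>N\<close> are below \<open>e\<close> by their weight
  alone. The finitely many others are bounded by their seminorms, which are eventually small
  simultaneously.\<close>

lemma frechet_dist_tendsto_0: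
  assumes "\<And>n. (\<lambda>k. p n (f k - g k)) \<longlonglongrightarrow> 0"
  shows "(\<lambda>k. frechet_dist p (f k) (g k)) \<longlonglongrightarrow> 0"
proof (rule tendstoI)
  fix e :: real assume "e > 0"
  then obtain N where N: "(1/2::real) ^ N < e"
    using real_arch_pow_inv[of e "1/2"] by auto
  have "\<forall>\<^sub>F k in sequentially. p n (f k - g k) < e" for n
    using order_tendstoD(2)[OF assms \<open>e > 0\<close>] .
  then have "\<forall>\<^sub>F k in sequentially. \<forall>n\<in>{..<N}. p n (f k - g k) < e"
    by (intro eventually_ball_finite) auto
  then show "\<forall>\<^sub>F k in sequentially. dist (frechet_dist p (f k) (g k)) 0 < e"
  proof eventually_elim
    case (elim k)
    obtain n where n: "frechet_dist p (f k) (g k) = dist_term (f k) (g k) n"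
      using frechet_dist_attained by blast
    have "dist_term (f k) (g k) n < e"
    proof (cases "n < N")
      case True
      let ?a = "p n (f k - g k)"
      have a: "0 \<le> ?a" "?a < e" using True elim seminorm_nonneg by auto
      have "dist_term (f k) (g k) n \<le> 1 * ?a / (1 + ?a)"
        unfolding dist_term_def using a power_le_one[of "1/2::real" n]
        by (intro divide_right_mono mult_right_mono) auto
      also have "\<dots> \<le> ?a" using a by (simp add: divide_simps algebra_simps)
      finally show ?thesis using a by simp
    next
      case False
      then have "(1/2::real) ^ n \<le> (1/2) ^ N" by (intro power_decreasing) auto
      with dist_term_le[of "f k" "g k" n] N show ?thesis by linarith
    qed
    then show ?case using n nonneg[of "f k" "g k"] by simp
  qed
qed

text \<open>Removing the weight from the n-th term leaves u = a/(1+a), where a is the seminorm. The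
  inverse a = u/(1-u) is continuous at u = 0.\<close>

lemma seminorm_tendsto_0:
  assumes "(\<lambda>k. frechet_dist p (f k) (g k)) \<longlonglongrightarrow> 0"
  shows "(\<lambda>k. p n (f k - g k)) \<longlonglongrightarrow> 0"
proof -
  define u where "u k = 2 ^ n * dist_term (f k) (g k) n" for k
  have "(\<lambda>k. dist_term (f k) (g k) n) \<longlonglongrightarrow> 0"
    by (rule tendsto_sandwich[OF _ _ tendsto_const assms])
       (auto simp: dist_term_nonneg dist_term_le_dist)
  then have "u \<longlonglongrightarrow> 2 ^ n * 0" unfolding u_def by (intro tendsto_intros)
  then have "(\<lambda>k. u k / (1 - u k)) \<longlonglongrightarrow> 0 / (1 - 0)" by (intro tendsto_intros) auto
  moreover have "u k / (1 - u k) = p n (f k - g k)" for k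
  proof -
    let ?a = "p n (f k - g k)"
    have a: "0 \<le> ?a" by (rule seminorm_nonneg)
    have "(2::real) ^ n * (1/2) ^ n = 1" by (simp flip: power_mult_distrib)
    then have "u k = ?a / (1 + ?a)" by (simp add: u_def dist_term_def)
    moreover from this a have "1 - u k = 1 / (1 + ?a)" by (simp add: field_simps)
    ultimately show ?thesis using a by simp
  qed
  ultimately show ?thesis by simp
qed

text \<open>The metric is not homogeneous, so continuity of scaling is read off from the seminorms,
  which are.\<close>

lemma scale_tendsto:
  assumes "t \<longlonglongrightarrow> l"
  shows "(\<lambda>k. frechet_dist p (t k *\<^sub>R c) (l *\<^sub>R c)) \<longlonglongrightarrow> 0"
proof (rule frechet_dist_tendsto_0)
  fix n
  have "(\<lambda>k. \<bar>t k - l\<bar> * p n c) \<longlonglongrightarrow> \<bar>l - l\<bar> * p n c" using assms by (intro tendsto_intros)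
  then show "(\<lambda>k. p n (t k *\<^sub>R c - l *\<^sub>R c)) \<longlonglongrightarrow> 0"
    by (simp add: seminorm_scale flip: scaleR_left_diff_distrib)
qed

lemma limitin_iff_dist_tendsto_0:
  "limitin mtopology f l sequentially \<longleftrightarrow> (\<lambda>k. frechet_dist p (f k) l) \<longlonglongrightarrow> 0"
  by (simp add: limitin_metric_dist_null)

text \<open>Compactness of [0,1] gives a uniform radius: otherwise there are points outside
  \<open>V\<close> ever closer to the segment, and along a convergent subsequence of their
  parameters they tend to a point of the segment, contradicting openness.\<close>

lemma segment_neighbourhood:
  assumes "openin mtopology V" and "\<And>t. 0 \<le> t \<Longrightarrow> t \<le> 1 \<Longrightarrow> y + t *\<^sub>R c \<in> V"
  obtains \<delta> where "\<delta> > 0"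
    "\<And>t z. 0 \<le> t \<Longrightarrow> t \<le> 1 \<Longrightarrow> frechet_dist p z (y + t *\<^sub>R c) < \<delta> \<Longrightarrow> z \<in> V"
proof (rule ccontr)
  assume "\<not> thesis"
  have "\<exists>t z. 0 \<le> t \<and> t \<le> 1 \<and> frechet_dist p z (y + t *\<^sub>R c) < inverse (real (Suc k)) \<and> z \<notin> V" for k
    using that[of "inverse (real (Suc k))"] \<open>\<not> thesis\<close> by force
  then obtain t z where tz: "\<And>k. 0 \<le> t k" "\<And>k. t k \<le> 1"
    "\<And>k. frechet_dist p (z k) (y + t k *\<^sub>R c) < inverse (real (Suc k))" "\<And>k. z k \<notin> V"
    by metis
  have "seq_compact {0..1::real}" by (simp add: compact_imp_seq_compact)
  then obtain l r where l: "l \<in> {0..1}" and r: "strict_mono (r :: nat \<Rightarrow> nat)" and tl: "(t \<circ> r) \<longlonglongrightarrow> l"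
    using tz by (auto elim: seq_compactE[of _ t])
  let ?b = "\<lambda>k. inverse (real (Suc (r k))) + frechet_dist p (t (r k) *\<^sub>R c) (l *\<^sub>R c)"
  have "?b \<longlonglongrightarrow> 0 + 0"
    using LIMSEQ_subseq_LIMSEQ[OF LIMSEQ_inverse_real_of_nat r] scale_tendsto[OF tl, of c]
    by (intro tendsto_add) (auto simp: o_def)
  moreover have "frechet_dist p (z (r k)) (y + l *\<^sub>R c) \<le> ?b k" for k
    using triangle[of "z (r k)" "y + t (r k) *\<^sub>R c" "y + l *\<^sub>R c"] tz(3)[of "r k"]
    by (simp add: frechet_dist_translate)
  ultimately have "(\<lambda>k. frechet_dist p (z (r k)) (y + l *\<^sub>R c)) \<longlonglongrightarrow> 0"
    by - (rule tendsto_sandwich[OF _ _ tendsto_const, where h = ?b], simp_all)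
  then have "limitin mtopology (z \<circ> r) (y + l *\<^sub>R c) sequentially"
    by (simp add: limitin_iff_dist_tendsto_0)
  then have "\<forall>\<^sub>F k in sequentially. z (r k) \<in> V"
    using assms l unfolding limitin_def by auto
  then show False using tz(4) by (auto simp: eventually_sequentially)
qed

lemma seminorm_box_scale:
  assumes "0 \<le> t" and "\<And>i. 0 \<le> s i" and "a \<in> seminorm_box p s"
  shows "p n (t *\<^sub>R a) \<le> t * s n"
  using assms by (auto simp: seminorm_box_def seminorm_scale intro: mult_left_mono)

end

section \<open>From the derivative condition to approximate solutions\<close>

text \<open>A single, late enough term of the sequence suffices. A finite bound on the extended
  infimum also rules out an empty image, and its strictness provides an actual point
  \<open>b\<close>.\<close>

lemma D'_step:
  assumes "v \<in> D' q F x y A" and "\<epsilon> > 0" and "\<eta> > 0"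
  obtains t a b where "0 < t" "t < \<eta>" "a \<in> A" "b \<in> F (x + t *\<^sub>R a)"
    "frechet_dist q b (y + t *\<^sub>R v) < \<epsilon> * t"
proof -
  obtain t :: "nat \<Rightarrow> real" where t: "\<And>n. 0 < t n" "t \<longlonglongrightarrow> 0"
    and lim: "(\<lambda>n. inf_dist (frechet_dist q) (mv_image F ((\<lambda>a. x + t n *\<^sub>R a) ` A)) (y + t n *\<^sub>R v)
            / ereal (t n)) \<longlonglongrightarrow> 0"
    using assms(1) unfolding D'_def by blast
  have "\<forall>\<^sub>F n in sequentially. t n < \<eta>" using order_tendstoD(2)[OF t(2) \<open>\<eta> > 0\<close>] .
  moreover have "\<forall>\<^sub>F n in sequentially. inf_dist (frechet_dist q)
      (mv_image F ((\<lambda>a. x + t n *\<^sub>R a) ` A)) (y + t n *\<^sub>R v) / ereal (t n) < ereal \<epsilon>"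
    using order_tendstoD(2)[OF lim, of "ereal \<epsilon>"] \<open>\<epsilon> > 0\<close> by simp
  ultimately obtain n where n: "t n < \<eta>" "inf_dist (frechet_dist q)
      (mv_image F ((\<lambda>a. x + t n *\<^sub>R a) ` A)) (y + t n *\<^sub>R v) / ereal (t n) < ereal \<epsilon>"
    using eventually_happens[OF eventually_conj] by fastforce
  then have "inf_dist (frechet_dist q) (mv_image F ((\<lambda>a. x + t n *\<^sub>R a) ` A)) (y + t n *\<^sub>R v)
      < ereal (\<epsilon> * t n)"
    using t(1)[of n] by (simp add: ereal_divide_less_iff mult.commute)
  then obtain a b where "a \<in> A" "b \<in> F (x + t n *\<^sub>R a)" "frechet_dist q b (y + t n *\<^sub>R v) < \<epsilon> * t n"
    unfolding inf_dist_def mv_image_def by (auto simp: INF_less_iff)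
  with that t n show thesis by blast
qed

text \<open>The condition \<open>deriv\<close> covers just the graph points that the path can visit:
  \<open>x\<close> in \<open>x0\<close> plus the box, and \<open>y\<close> in the closed
  \<open>\<epsilon>\<close>-tube around the segment from \<open>y0\<close> to
  \<open>y0 + c\<close>.\<close>

lemma approximate_solution:
  fixes p :: "nat \<Rightarrow> 'a::real_vector \<Rightarrow> real" and q :: "nat \<Rightarrow> 'b::real_vector \<Rightarrow> real"
  assumes "frechet_space p" and "frechet_space q"
    and closed: "closedin (prod_topology (frechet_topology p) (frechet_topology q)) (Gr F)"
    and s: "\<And>i. 0 \<le> s i"
    and compact: "compactin (frechet_topology p) (seminorm_box p s)"
    and y0: "y0 \<in> F x0"
    and \<epsilon>: "\<epsilon> > 0"
    and deriv: "\<And>x y t. y \<in> F x \<Longrightarrow> 0 \<le> t \<Longrightarrow> t \<le> 1 \<Longrightarrow> x - x0 \<in> seminorm_box p s \<Longrightarrow>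
      frechet_dist q y (y0 + t *\<^sub>R c) \<le> \<epsilon> \<Longrightarrow> c \<in> D' q F x y (seminorm_box p s)"
  shows "\<exists>x y. y \<in> F x \<and> x - x0 \<in> seminorm_box p s \<and> frechet_dist q y (y0 + c) \<le> \<epsilon>"
proof -
  interpret X: frechet_space p by fact
  interpret Y: frechet_space q by fact
  txt \<open>A state \<open>(t, x, w)\<close> stands for the point \<open>(x, w + t c)\<close> of the graph: subtracting the drift
    \<open>t c\<close> makes increasing sequences of states Cauchy in \<open>w\<close>.\<close>
  define R where "R = (\<lambda>(t, x, w) (t', x', w'). t \<le> t' \<and> (\<forall>n. p n (x' - x) \<le> (t' - t) * s n) \<and>
    frechet_dist q w' w \<le> \<epsilon> * (t' - t))"
  \<comment> \<open>Being above \<open>(0, x0, y0)\<close> records that \<open>x - x0\<close> lies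
    in \<open>t\<close> times the box and \<open>w\<close> within \<open>\<epsilon> * t\<close> of
    \<open>y0\<close>.\<close>
  define S where "S = {(t, x, w). t \<le> 1 \<and> w + t *\<^sub>R c \<in> F x \<and> R (0, x0, y0) (t, x, w)}"
  have p0: "p n 0 = 0" for n using X.separating[of 0] by simp
  have R_refl: "R z z" for z by (auto simp: R_def p0 split: prod.split)
  \<comment> \<open>All bounds are linear in the time increment, so they add up under the triangle
    inequality.\<close>
  have R_trans: "R u w" if uv: "R u v" and vw: "R v w" for u v w
  proof -
    obtain t x a t' x' a' t'' x'' a'' where eqs: "u = (t, x, a)" "v = (t', x', a')" "w = (t'', x'', a'')"
      by (metis prod_cases3)
    have "p n (x'' - x) \<le> (t'' - t) * s n" for n
    proof -
      have "p n (x'' - x) \<le> p n (x'' - x') + p n (x' - x)"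
        using X.seminorm_triangle[of n "x'' - x'" "x' - x"] by simp
      also have "\<dots> \<le> (t'' - t') * s n + (t' - t) * s n"
        using uv vw by (intro add_mono) (auto simp: R_def eqs)
      finally show ?thesis by (simp add: algebra_simps)
    qed
    moreover have "frechet_dist q a'' a \<le> \<epsilon> * (t'' - t)"
      using Y.triangle[of a'' a' a] uv vw by (auto simp: R_def eqs algebra_simps)
    ultimately show ?thesis using uv vw by (auto simp: R_def eqs)
  qed
  have S_box: "x - x0 \<in> seminorm_box p s" if "(t, x, w) \<in> S" for t x w
  proof -
    have "p n (x - x0) \<le> s n" for n
    proof -
      have "p n (x - x0) \<le> t * s n" using that by (simp add: S_def R_def)
      also have "\<dots> \<le> 1 * s n" using that s by (intro mult_right_mono) (auto simp: S_def)
      finally show ?thesis by simp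
    qed
    then show ?thesis by (simp add: seminorm_box_def)
  qed
  have S_dist: "frechet_dist q (w + t *\<^sub>R c) (y0 + t *\<^sub>R c) \<le> \<epsilon> * t" if "(t, x, w) \<in> S" for t x w
    using that Y.frechet_dist_translate[of "t *\<^sub>R c" w y0] by (simp add: S_def R_def add.commute)
  have "\<exists>z\<in>S. fst z = 1"
  proof (rule brezis_browder[where R = R and \<tau> = fst])
    show "(0, x0, y0) \<in> S" using y0 R_refl by (simp add: S_def)
    show "fst u \<le> fst v" if "R u v" for u v using that by (auto simp: R_def)
    show "fst z \<le> 1" if "z \<in> S" for z using that by (auto simp: S_def)
    show "\<exists>z'\<in>S. R z z' \<and> fst z < fst z'" if z: "z \<in> S" and "fst z < 1" for z
    proof -
      obtain t x w where eq: "z = (t, x, w)" by (rule prod_cases3)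
      have t: "0 \<le> t" "t < 1" "w + t *\<^sub>R c \<in> F x" "R (0, x0, y0) z"
        using z \<open>fst z < 1\<close> by (auto simp: S_def R_def eq)
      have "\<epsilon> * t \<le> \<epsilon>" using t \<epsilon> by simp
      then have "c \<in> D' q F x (w + t *\<^sub>R c) (seminorm_box p s)"
        using deriv t S_box S_dist z eq by (meson order_trans less_imp_le)
      \<comment> \<open>The choice \<open>1 - t\<close> for the step bound keeps the new time below
        1.\<close>
      then obtain h a b where h: "0 < h" "h < 1 - t" "a \<in> seminorm_box p s" "b \<in> F (x + h *\<^sub>R a)"
        and b: "frechet_dist q b (w + t *\<^sub>R c + h *\<^sub>R c) < \<epsilon> * h"
        using D'_step[of c q F x "w + t *\<^sub>R c" "seminorm_box p s" \<epsilon> "1 - t"] \<epsilon> t by auto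
      \<comment> \<open>Removing the drift of the new time makes \<open>b\<close> the graph value of
        this state and moves \<open>w\<close> by less than \<open>\<epsilon> * h\<close>.\<close>
      let ?z = "(t + h, x + h *\<^sub>R a, b - (t + h) *\<^sub>R c)"
      have "frechet_dist q (b - (t + h) *\<^sub>R c) w = frechet_dist q b (w + t *\<^sub>R c + h *\<^sub>R c)"
        using Y.frechet_dist_translate[of "(t + h) *\<^sub>R c" "b - (t + h) *\<^sub>R c" w]
        by (simp add: algebra_simps)
      then have "R z ?z"
        using h b s X.seminorm_box_scale[of h s a] by (simp add: R_def eq)
      moreover from this have "?z \<in> S" using R_trans t h by (simp add: S_def)
      ultimately show ?thesis using h eq by force
    qed
    show "\<exists>z\<in>S. \<forall>k. R (f k) z" if fS: "\<And>k. f k \<in> S" and fR: "\<And>k. R (f k) (f (Suc k))" for f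
    proof -
      define t x w where "t k = fst (f k)" and "x k = fst (snd (f k))" and "w k = snd (snd (f k))" for k
      have f_eq: "f k = (t k, x k, w k)" for k by (simp add: t_def x_def w_def)
      have R_le: "R (f j) (f k)" if "j \<le> k" for j k
        using that by (induction rule: dec_induct) (use R_refl R_trans fR in blast)+
      then have mono_t: "incseq t" by (auto simp: incseq_def R_def f_eq)
      have S_fk: "t k \<le> 1" "w k + t k *\<^sub>R c \<in> F (x k)" "R (0, x0, y0) (f k)" for k
        using fS[of k] by (auto simp: S_def f_eq)
      obtain l where l: "t \<longlonglongrightarrow> l" "\<And>k. t k \<le> l"
        using incseq_convergent[OF mono_t, of 1] S_fk by auto
      have dist_w: "frechet_dist q (w k) (w j) \<le> \<epsilon> * (t k - t j)" if "j \<le> k" for j k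
        using R_le[OF that] by (simp add: R_def f_eq)
      \<comment> \<open>Distances in \<open>w\<close> are controlled by increments of the bounded
        monotone sequence \<open>t\<close>.\<close>
      have "Y.MCauchy w"
        unfolding Y.MCauchy_def
      proof (intro conjI allI impI)
        fix e :: real assume "e > 0"
        then have "e / \<epsilon> > 0" using \<epsilon> by simp
        then obtain N where N: "\<And>m n. N \<le> m \<Longrightarrow> N \<le> n \<Longrightarrow> \<bar>t m - t n\<bar> < e / \<epsilon>"
          using LIMSEQ_imp_Cauchy[OF l(1)] unfolding Cauchy_def dist_real_def by meson
        have less: "frechet_dist q (w k) (w j) < e" if "N \<le> j" "j \<le> k" for j k
        proof -
          have "\<epsilon> * (t k - t j) < e"
            using N[of k j] that \<epsilon> by (simp add: pos_less_divide_eq mult.commute abs_less_iff)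
          then show ?thesis using dist_w[OF that(2)] by simp
        qed
        have "frechet_dist q (w m) (w n) < e" if "N \<le> m" "N \<le> n" for m n
          using less[of m n] less[of n m] that Y.commute[of "w m" "w n"] by (cases m n rule: linorder_cases) auto
        then show "\<exists>N. \<forall>m n. N \<le> m \<longrightarrow> N \<le> n \<longrightarrow> frechet_dist q (w m) (w n) < e" by blast
      qed auto
      then obtain w' where "limitin Y.mtopology w w' sequentially"
        using Y.complete unfolding Y.mcomplete_def by blast
      then have w': "(\<lambda>k. frechet_dist q (w k) w') \<longlonglongrightarrow> 0"
        by (simp add: Y.limitin_iff_dist_tendsto_0)
      \<comment> \<open>In the first variable compactness of the box supplies a limit along a
        subsequence \<open>r\<close>; the limits of \<open>t\<close> and \<open>w\<close> persist
        along it.\<close>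
      have "range (\<lambda>k. x k - x0) \<subseteq> seminorm_box p s" using S_box fS f_eq by auto
      then obtain a r where r: "strict_mono (r :: nat \<Rightarrow> nat)"
        and "limitin X.mtopology ((\<lambda>k. x k - x0) \<circ> r) a sequentially"
        using compact unfolding X.compactin_sequentially by blast
      moreover have "frechet_dist p (x k - x0) a = frechet_dist p (x k) (x0 + a)" for k
        using X.frechet_dist_translate[of x0 "x k - x0" a] by simp
      ultimately have x': "(\<lambda>k. frechet_dist p (x (r k)) (x0 + a)) \<longlonglongrightarrow> 0"
        by (simp add: X.limitin_iff_dist_tendsto_0)
      have wr: "(\<lambda>k. frechet_dist q (w (r k)) w') \<longlonglongrightarrow> 0"
        using LIMSEQ_subseq_LIMSEQ[OF w' r] by (simp add: o_def)
      have tr: "(\<lambda>k. t (r k)) \<longlonglongrightarrow> l"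
        using LIMSEQ_subseq_LIMSEQ[OF l(1) r] by (simp add: o_def)
      \<comment> \<open>For fixed \<open>j\<close> the relation to \<open>f (r k)\<close> holds once
        \<open>k\<close> is at least \<open>j\<close>, as \<open>r k\<close> is at least
        \<open>k\<close>. Each bound survives the limit, up to an error term that tends to
        0.\<close>
      have upper: "R (f j) (l, x0 + a, w')" for j
      proof -
        have late: "\<forall>\<^sub>F k in sequentially. R (f j) (f (r k))"
          using eventually_ge_at_top[of j]
          by eventually_elim (use R_le seq_suble[OF r] order_trans in blast)
        have "p n (x0 + a - x j) \<le> (l - t j) * s n" for n
        proof (rule tendsto_le)
          show "(\<lambda>k. p n (x (r k) - (x0 + a)) + (t (r k) - t j) * s n) \<longlonglongrightarrow> (l - t j) * s n"
            using tendsto_add[OF X.seminorm_tendsto_0[OF x', of n]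
                tendsto_mult[OF tendsto_diff[OF tr tendsto_const[of "t j"]] tendsto_const[of "s n"]]] by simp
          show "\<forall>\<^sub>F k in sequentially. p n (x0 + a - x j) \<le> p n (x (r k) - (x0 + a)) + (t (r k) - t j) * s n"
            using late
          proof eventually_elim
            case (elim k)
            then have "p n (x (r k) - x j) \<le> (t (r k) - t j) * s n" by (simp add: R_def f_eq)
            moreover have "p n (x0 + a - x j) \<le> p n (x0 + a - x (r k)) + p n (x (r k) - x j)"
              using X.seminorm_triangle[of n "x0 + a - x (r k)" "x (r k) - x j"] by simp
            ultimately show ?case by (simp add: X.seminorm_minus_commute[of n "x (r k)" "x0 + a"])
          qed
        qed auto
        moreover have "frechet_dist q w' (w j) \<le> \<epsilon> * (l - t j)"
        proof (rule tendsto_le)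
          show "(\<lambda>k. frechet_dist q (w (r k)) w' + \<epsilon> * (t (r k) - t j)) \<longlonglongrightarrow> \<epsilon> * (l - t j)"
            using tendsto_add[OF wr tendsto_mult[OF tendsto_const[of \<epsilon>]
                tendsto_diff[OF tr tendsto_const[of "t j"]]]] by simp
          show "\<forall>\<^sub>F k in sequentially. frechet_dist q w' (w j) \<le> frechet_dist q (w (r k)) w' + \<epsilon> * (t (r k) - t j)"
            using late
          proof eventually_elim
            case (elim k)
            then show ?case
              using Y.triangle[of w' "w (r k)" "w j"] Y.commute[of w' "w (r k)"] by (simp add: R_def f_eq)
          qed
        qed auto
        ultimately show ?thesis using l by (simp add: R_def f_eq)
      qed
      \<comment> \<open>Adding the drift back gives convergence of the graph points themselves, so
        that closedness of the graph applies to the limit state.\<close>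
      have "(\<lambda>k. frechet_dist q (w (r k) + t (r k) *\<^sub>R c) (w' + l *\<^sub>R c)) \<longlonglongrightarrow> 0"
      proof (rule tendsto_sandwich[OF _ _ tendsto_const])
        show "(\<lambda>k. frechet_dist q (w (r k)) w' + frechet_dist q (t (r k) *\<^sub>R c) (l *\<^sub>R c)) \<longlonglongrightarrow> 0"
          using tendsto_add[OF wr Y.scale_tendsto[OF tr]] by simp
        \<comment> \<open>Translation invariance, used once in each summand.\<close>
        have "frechet_dist q (u + v) (u' + v') \<le> frechet_dist q u u' + frechet_dist q v v'" for u u' v v'
          using Y.triangle[of "u + v" "u' + v" "u' + v'"] Y.frechet_dist_translate[of v u u']
            Y.frechet_dist_translate[of u' v v'] by (simp add: add.commute)
        then show "\<forall>\<^sub>F k in sequentially. frechet_dist q (w (r k) + t (r k) *\<^sub>R c) (w' + l *\<^sub>R c)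
            \<le> frechet_dist q (w (r k)) w' + frechet_dist q (t (r k) *\<^sub>R c) (l *\<^sub>R c)" by simp
      qed auto
      with x' have "limitin (prod_topology X.mtopology Y.mtopology)
          (\<lambda>k. (x (r k), w (r k) + t (r k) *\<^sub>R c)) (x0 + a, w' + l *\<^sub>R c) sequentially"
        by (simp add: limitin_pairwise o_def X.limitin_iff_dist_tendsto_0 Y.limitin_iff_dist_tendsto_0)
      from limitin_closedin[OF this closed] have "w' + l *\<^sub>R c \<in> F (x0 + a)"
        using S_fk by (simp add: Gr_def)
      moreover have "l \<le> 1" using LIMSEQ_le_const2[OF l(1)] S_fk by blast
      ultimately have "(l, x0 + a, w') \<in> S"
        using R_trans[OF S_fk(3) upper] by (simp add: S_def)
      with upper show ?thesis by blast
    qed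
  qed (use R_refl R_trans in blast)+
  then obtain x w where xw: "(1, x, w) \<in> S" by force
  then have "w + 1 *\<^sub>R c \<in> F x" by (simp add: S_def)
  with S_box[OF xw] S_dist[OF xw] show ?thesis by auto
qed

section \<open>Letting the error tend to 0\<close>

theorem corollary3:
  fixes p :: "nat \<Rightarrow> 'a::real_vector \<Rightarrow> real"
    and q :: "nat \<Rightarrow> 'b::real_vector \<Rightarrow> real"
    and F :: "'a \<Rightarrow> 'b set"
    and U :: "'a set" and V :: "'b set"
    and s :: "nat \<Rightarrow> real" and C :: "'b set"
  assumes "frechet_space p" and "frechet_space q"
    and "closedin (prod_topology (frechet_topology p) (frechet_topology q)) (Gr F)"
    and "openin (frechet_topology p) U" and "openin (frechet_topology q) V"
    and "Gr F \<inter> (U \<times> V) \<noteq> {}"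
    and "\<And>i. 0 \<le> s i" and "C \<noteq> {}"
    and "\<And>x y. (x, y) \<in> (U \<times> V) \<inter> Gr F \<Longrightarrow> C \<subseteq> D' q F x y (seminorm_box p s)"
    and "compactin (frechet_topology p) (seminorm_box p s)"
  shows "\<forall>(x, y) \<in> Gr F. (+) x ` seminorm_box p s \<subseteq> U \<and> segments y C \<subseteq> V \<longrightarrow>
           (+) y ` C \<subseteq> mv_image F ((+) x ` seminorm_box p s)"
proof clarify
  interpret X: frechet_space p by fact
  interpret Y: frechet_space q by fact
  fix x y c
  assume "(x, y) \<in> Gr F" and xU: "(+) x ` seminorm_box p s \<subseteq> U" and yV: "segments y C \<subseteq> V" and "c \<in> C"
  then have y: "y \<in> F x" by (simp add: Gr_def)
  have "y + t *\<^sub>R c \<in> V" if "0 \<le> t" "t \<le> 1" for t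
    using yV \<open>c \<in> C\<close> that unfolding segments_def by blast
  then obtain \<delta> where \<delta>: "\<delta> > 0"
    "\<And>t z. 0 \<le> t \<Longrightarrow> t \<le> 1 \<Longrightarrow> frechet_dist q z (y + t *\<^sub>R c) < \<delta> \<Longrightarrow> z \<in> V"
    using Y.segment_neighbourhood[OF \<open>openin (frechet_topology q) V\<close>] by metis
  \<comment> \<open>The factor 1/2 makes \<open>e k\<close> strictly less than
    \<open>\<delta>\<close> already for \<open>k = 0\<close>, so every closed tube of radius
    \<open>e k\<close> lies in \<open>V\<close>.\<close>
  define e where "e k = \<delta> / 2 * inverse (real (Suc k))" for k
  have e: "0 < e k" "e k < \<delta>" for k
    using \<delta>(1) by (auto simp: e_def field_simps) (smt (verit) mult_nonneg_nonneg of_nat_0_le_iff)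
  have "\<exists>x' y'. y' \<in> F x' \<and> x' - x \<in> seminorm_box p s \<and> frechet_dist q y' (y + c) \<le> e k" for k
  proof (rule approximate_solution)
    fix x' y' and t :: real
    assume "y' \<in> F x'" "0 \<le> t" "t \<le> 1" "x' - x \<in> seminorm_box p s" "frechet_dist q y' (y + t *\<^sub>R c) \<le> e k"
    moreover from this have "y' \<in> V" using \<delta>(2) e(2)[of k] by (meson order_le_less_trans)
    moreover have "x' \<in> U" using xU calculation(4) by (metis add_diff_cancel_left' diff_add_cancel add.commute image_subset_iff)
    ultimately show "c \<in> D' q F x' y' (seminorm_box p s)"
      using assms(9)[of x' y'] \<open>c \<in> C\<close> by (auto simp: Gr_def)
  qed (use assms e y in auto)
  then obtain x' y' where approx: "\<And>k. y' k \<in> F (x' k)" "\<And>k. x' k - x \<in> seminorm_box p s"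
    "\<And>k. frechet_dist q (y' k) (y + c) \<le> e k" by metis
  \<comment> \<open>The approximate solutions have no reason to converge in the first variable, so
    compactness is used again; in the second they tend to \<open>y + c\<close>, and the closed graph
    gives an exact solution.\<close>
  have "range (\<lambda>k. x' k - x) \<subseteq> seminorm_box p s" using approx by auto
  then obtain a r where a: "a \<in> seminorm_box p s" and r: "strict_mono (r :: nat \<Rightarrow> nat)"
    and "limitin X.mtopology ((\<lambda>k. x' k - x) \<circ> r) a sequentially"
    using assms(10) unfolding X.compactin_sequentially by blast
  moreover have "frechet_dist p (x' k - x) a = frechet_dist p (x' k) (x + a)" for k
    using X.frechet_dist_translate[of x "x' k - x" a] by simp
  ultimately have "(\<lambda>k. frechet_dist p (x' (r k)) (x + a)) \<longlonglongrightarrow> 0"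
    by (simp add: X.limitin_iff_dist_tendsto_0)
  moreover have "e \<longlonglongrightarrow> \<delta> / 2 * 0"
    unfolding e_def by (intro tendsto_mult tendsto_const LIMSEQ_inverse_real_of_nat)
  then have "(\<lambda>k. frechet_dist q (y' k) (y + c)) \<longlonglongrightarrow> 0"
    using approx by - (rule tendsto_sandwich[OF _ _ tendsto_const, where h = e], simp_all)
  from LIMSEQ_subseq_LIMSEQ[OF this r] have "(\<lambda>k. frechet_dist q (y' (r k)) (y + c)) \<longlonglongrightarrow> 0"
    by (simp add: o_def)
  ultimately have "limitin (prod_topology X.mtopology Y.mtopology)
      (\<lambda>k. (x' (r k), y' (r k))) (x + a, y + c) sequentially"
    by (simp add: limitin_pairwise o_def X.limitin_iff_dist_tendsto_0 Y.limitin_iff_dist_tendsto_0)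
  from limitin_closedin[OF this assms(3)] have "y + c \<in> F (x + a)"
    using approx by (simp add: Gr_def)
  with a show "y + c \<in> mv_image F ((+) x ` seminorm_box p s)"
    by (auto simp: mv_image_def)
qed

end
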